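(* $VW^*_{Rel}\le_I VW_0$; that is, the first-order theory $VW^*_{Rel}$ is interpretable in the first-order theory $VW_0$ (both defined in the context).
   Context: $T\le_I S$ means that $T$ is (relatively) formally interpretable in $S$ in the usual sense. Both theories include the usual axioms for identity. Strings: $\Sigma^*$ is the set of finite words over $\{1,2\}$, including the empty word $e$; $^\frown$ is concatenation; $s\sqsubseteq t$ between strings means $s$ is an initial segment of $t$, and $s\sqsupseteq t$ means $s$ is an end segment of $t$ (both possibly improper). $D=\{1,2\}$. The same symbols are used for binary relation symbols. Both vocabularies contain a constant $\underline{s}$ for each $s\in\Sigma^*$. $VW^*_{Rel}$: vocabulary: the constants $\underline{s}$, binary relation symbols $A^{\wedge}_1,A^{\wedge}_2,A^{\vee}_1,A^{\vee}_2$ (expressing the graphs of $x\mapsto x^\frown1$, $x\mapsto x^\frown2$, $x\mapsto1^\frown x$, $x\mapsto2^\frown x$), and binary relation symbols $\sqsubseteq,\sqsupseteq$. Axioms (for all $s,t\in\Sigma^*$, $d\in D$): (1) $\neg(\underline{s}=\underline{t})$ for distinct $s,t$; (2) $A^{\wedge}_d(\underline{s},\underline{s^\frown d})$; (3) $A^{\vee}_d(\underline{s},\underline{d^\frown s})$; (4) $\forall y\big(A^{\wedge}_d(\underline{t},y)\to\forall z(z\sqsubseteq y\leftrightarrow z\sqsubseteq\underline{t}\vee z=y)\big)$; (5) $\forall y\big(A^{\vee}_d(\underline{t},y)\to\forall z(z\sqsupseteq y\leftrightarrow z\sqsupseteq\underline{t}\vee z=y)\big)$; (6) $\forall x\exists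 y\,A^{\wedge}_d(x,y)$; (7) $\forall x\exists y\,A^{\vee}_d(x,y)$; (8) $\forall x,y,z(A^{\wedge}_d(x,y)\ \&\ A^{\wedge}_d(x,z)\to y=z)$; (9) $\forall x,y,z(A^{\vee}_d(x,y)\ \&\ A^{\vee}_d(x,z)\to y=z)$; together with $\underline{e}\sqsubseteq\underline{t}$; $\forall x(x\sqsubseteq\underline{e}\to x=\underline{e})$; $\underline{e}\sqsupseteq\underline{t}$; $\forall x(x\sqsupseteq\underline{e}\to x=\underline{e})$; and $\forall x,y(x\sqsubseteq y\ \&\ y\sqsubseteq x\to x=y)$. $VW_0$: vocabulary: the constants $\underline{s}$ and the binary relation symbols $\sqsubseteq,\sqsupseteq$. Write $x\sqsubset y$ for $x\sqsubseteq y\ \&\ x\ne y$ and $x\sqsupset y$ for $x\sqsupseteq y\ \&\ x\ne y$. Axioms: ($VW_0$1) $\neg\,\underline{s}=\underline{t}$ for distinct $s,t\in\Sigma^*$; ($VW_0$2) $\forall x(x\sqsubseteq\underline{t}\leftrightarrow\bigvee_{s\sqsubseteq t}x=\underline{s})$ for $t\in\Sigma^*$; ($VW_0$3) $\forall x(x\sqsupseteq\underline{t}\leftrightarrow\bigvee_{s\sqsupseteq t}x=\underline{s})$ for $t\in\Sigma^*$; ($VW_0$4) $\forall x\big(\forall y(y\sqsubset x\leftrightarrow y\sqsubset\underline{t})\to\bigwedge_{d\in D}(\underline{d}\sqsupseteq x\ \&\ \underline{d}\sqsupseteq\underline{t}\to x=\underline{t})\big)$ for $t\in\Sigma^*$;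 ($VW_0$5) $\forall x\big(\forall y(y\sqsupset x\leftrightarrow y\sqsupset\underline{t})\to\bigwedge_{d\in D}(\underline{d}\sqsubseteq x\ \&\ \underline{d}\sqsubseteq\underline{t}\to x=\underline{t})\big)$ for $t\in\Sigma^*$; (VW10) $\forall x,y(x\sqsubseteq y\ \&\ y\sqsubseteq x\to x=y)$. *)

theory Defs
  imports "HOL-Library.Sublist"
begin

section \<open>First-order logic with identity\<close>

text \<open>
  A vocabulary consists of constants (elements of the type \<open>'c\<close>) and binary relation symbols
  (elements of \<open>'r\<close>); no other kind of symbol occurs in the theories below.
  Variables are de Bruijn indices.
\<close>

datatype 'c trm = Var nat | Const 'c

datatype ('c, 'r) fm =
    Falsum
  | Eq "'c trm" "'c trm"
  | Rel 'r "'c trm" "'c trm"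
  | Imp "('c, 'r) fm" "('c, 'r) fm"
  | All "('c, 'r) fm"

abbreviation Neg where "Neg p \<equiv> Imp p Falsum"
abbreviation Or where "Or p q \<equiv> Imp (Neg p) q"
abbreviation And where "And p q \<equiv> Neg (Imp p (Neg q))"
abbreviation Iff where "Iff p q \<equiv> And (Imp p q) (Imp q p)"
abbreviation Ex where "Ex p \<equiv> Neg (All (Neg p))"

definition Disj :: "('c, 'r) fm list \<Rightarrow> ('c, 'r) fm" where
  "Disj ps = foldr Or ps Falsum"

definition Conj :: "('c, 'r) fm list \<Rightarrow> ('c, 'r) fm" where
  "Conj ps = foldr And ps (Neg Falsum)"

primrec subst_trm :: "(nat \<Rightarrow> 'c trm) \<Rightarrow> 'c trm \<Rightarrow> 'c trm" where
  "subst_trm \<sigma> (Var n) = \<sigma> n"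
| "subst_trm \<sigma> (Const c) = Const c"

abbreviation lift_trm :: "'c trm \<Rightarrow> 'c trm" where
  "lift_trm \<equiv> subst_trm (\<lambda>n. Var (Suc n))"

primrec subst :: "(nat \<Rightarrow> 'c trm) \<Rightarrow> ('c, 'r) fm \<Rightarrow> ('c, 'r) fm" where
  "subst \<sigma> Falsum = Falsum"
| "subst \<sigma> (Eq s t) = Eq (subst_trm \<sigma> s) (subst_trm \<sigma> t)"
| "subst \<sigma> (Rel r s t) = Rel r (subst_trm \<sigma> s) (subst_trm \<sigma> t)"
| "subst \<sigma> (Imp p q) = Imp (subst \<sigma> p) (subst \<sigma> q)"
| "subst \<sigma> (All p) = All (subst (case_nat (Var 0) (\<lambda>n. lift_trm (\<sigma> n))) p)"

abbreviation lift :: "('c, 'r) fm \<Rightarrow> ('c, 'r) fm" where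
  "lift \<equiv> subst (\<lambda>n. Var (Suc n))"

text \<open>\<open>inst t p\<close> replaces variable 0 of \<open>p\<close> by \<open>t\<close> and renumbers the remaining free variables.\<close>

definition inst :: "'c trm \<Rightarrow> ('c, 'r) fm \<Rightarrow> ('c, 'r) fm" where
  "inst t = subst (case_nat t Var)"

primrec trm_vars_below :: "nat \<Rightarrow> 'c trm \<Rightarrow> bool" where
  "trm_vars_below k (Var n) \<longleftrightarrow> n < k"
| "trm_vars_below k (Const c) \<longleftrightarrow> True"

text \<open>All free variables of the formula are among \<open>0, \<dots>, k - 1\<close>; sentences are the case \<open>k = 0\<close>.\<close>

primrec vars_below :: "nat \<Rightarrow> ('c, 'r) fm \<Rightarrow> bool" where
  "vars_below k Falsum \<longleftrightarrow> True"
| "vars_below k (Eq s t) \<longleftrightarrow> trm_vars_below k s \<and> trm_vars_below k t"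
| "vars_below k (Rel r s t) \<longleftrightarrow> trm_vars_below k s \<and> trm_vars_below k t"
| "vars_below k (Imp p q) \<longleftrightarrow> vars_below k p \<and> vars_below k q"
| "vars_below k (All p) \<longleftrightarrow> vars_below (Suc k) p"

text \<open>
  Provability is classical natural deduction. The rules \<open>eq_refl\<close> and \<open>eq_subst\<close> give every
  theory the usual axioms for identity, so these are not listed among the axioms of a theory.
\<close>

inductive proves :: "('c, 'r) fm set \<Rightarrow> ('c, 'r) fm \<Rightarrow> bool" (infix "\<turnstile>" 50) where
  assm: "p \<in> G \<Longrightarrow> G \<turnstile> p"
| imp_intro: "insert p G \<turnstile> q \<Longrightarrow> G \<turnstile> Imp p q"
| imp_elim: "G \<turnstile> Imp p q \<Longrightarrow> G \<turnstile> p \<Longrightarrow> G \<turnstile> q"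
| classical: "insert (Neg p) G \<turnstile> Falsum \<Longrightarrow> G \<turnstile> p"
| all_intro: "lift ` G \<turnstile> p \<Longrightarrow> G \<turnstile> All p"
| all_elim: "G \<turnstile> All p \<Longrightarrow> G \<turnstile> inst t p"
| eq_refl: "G \<turnstile> Eq t t"
| eq_subst: "G \<turnstile> Eq s t \<Longrightarrow> G \<turnstile> inst s p \<Longrightarrow> G \<turnstile> inst t p"


section \<open>Relative interpretability\<close>

text \<open>
  A translation of the vocabulary \<open>('c, 'r)\<close> into \<open>('d, 'q)\<close> consists of
  a domain formula in the variable 0, a formula in the variable 0 for each constant
  (defining its denotation), and a formula in the variables 0 and 1 for each relation symbol
  (0 standing for the first argument, 1 for the second). Identity is translated as identity.
\<close>

record ('c, 'r, 'd, 'q) translation =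
  Dom :: "('d, 'q) fm"
  Cst :: "'c \<Rightarrow> ('d, 'q) fm"
  Rl :: "'r \<Rightarrow> ('d, 'q) fm"

definition wf_translation :: "('c, 'r, 'd, 'q) translation \<Rightarrow> bool" where
  "wf_translation I \<longleftrightarrow>
     vars_below 1 (Dom I) \<and> (\<forall>c. vars_below 1 (Cst I c)) \<and> (\<forall>r. vars_below 2 (Rl I r))"

text \<open>
  \<open>with_value I t p\<close> expresses that \<open>p\<close> holds when its variable 0 takes the value of the
  term \<open>t\<close> of the source language. A constant is eliminated in favour of its defining formula.
\<close>

primrec with_value ::
  "('c, 'r, 'd, 'q) translation \<Rightarrow> 'c trm \<Rightarrow> ('d, 'q) fm \<Rightarrow> ('d, 'q) fm" where
  "with_value I (Var n) p = inst (Var n) p"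
| "with_value I (Const c) p = Ex (And (And (Dom I) (Cst I c)) p)"

primrec translate :: "('c, 'r, 'd, 'q) translation \<Rightarrow> ('c, 'r) fm \<Rightarrow> ('d, 'q) fm" where
  "translate I Falsum = Falsum"
| "translate I (Eq s t) =
     with_value I t (with_value I (lift_trm s) (Eq (Var 0) (Var 1)))"
| "translate I (Rel r s t) =
     with_value I t (with_value I (lift_trm s) (Rl I r))"
| "translate I (Imp p q) = Imp (translate I p) (translate I q)"
| "translate I (All p) = All (Imp (Dom I) (translate I p))"

text \<open>In the scope of the second quantifier the new variable is 0 and the old one is 1.\<close>

definition Ex_unique :: "('c, 'r) fm \<Rightarrow> ('c, 'r) fm" where
  "Ex_unique p =
     Ex (And p (All (Imp (subst (case_nat (Var 0) (\<lambda>n. Var (n + 2))) p) (Eq (Var 0) (Var 1)))))"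

definition interpretable :: "('c, 'r) fm set \<Rightarrow> ('d, 'q) fm set \<Rightarrow> bool"
    (infix "\<le>\<^sub>I" 50) where
  "T \<le>\<^sub>I S \<longleftrightarrow>
     (\<exists>I :: ('c, 'r, 'd, 'q) translation.
        wf_translation I \<and>
        S \<turnstile> Ex (Dom I) \<and>
        (\<forall>c. S \<turnstile> Ex_unique (And (Dom I) (Cst I c))) \<and>
        (\<forall>p \<in> T. S \<turnstile> translate I p))"


section \<open>The theories\<close>

datatype letter = L1 | L2

type_synonym word = "letter list"

text \<open>
  \<open>Sublist.prefixes t\<close> and \<open>Sublist.suffixes t\<close> list all initial, respectively end,
  segments of \<open>t\<close>, including \<open>[]\<close> and \<open>t\<close>.

  \<open>SInit x y\<close> and \<open>Init x y\<close> say that \<open>x\<close> is an initial segment of \<open>y\<close>;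
  \<open>SEnd x y\<close> and \<open>End x y\<close> say that \<open>x\<close> is an end segment of \<open>y\<close>.
\<close>

datatype vw_star_sym =
    App letter    \<comment> \<open>\<open>App d x y\<close>: \<open>y\<close> is \<open>x\<close> followed by \<open>d\<close>\<close>
  | Prep letter   \<comment> \<open>\<open>Prep d x y\<close>: \<open>y\<close> is \<open>d\<close> followed by \<open>x\<close>\<close>
  | SInit
  | SEnd

inductive_set VW_star_Rel :: "(word, vw_star_sym) fm set" where
  ax1: "s \<noteq> t \<Longrightarrow> Neg (Eq (Const s) (Const t)) \<in> VW_star_Rel"
| ax2: "Rel (App d) (Const s) (Const (s @ [d])) \<in> VW_star_Rel"
| ax3: "Rel (Prep d) (Const s) (Const (d # s)) \<in> VW_star_Rel"
| ax4: "All (Imp (Rel (App d) (Const t) (Var 0))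
          (All (Iff (Rel SInit (Var 0) (Var 1))
                    (Or (Rel SInit (Var 0) (Const t)) (Eq (Var 0) (Var 1)))))) \<in> VW_star_Rel"
| ax5: "All (Imp (Rel (Prep d) (Const t) (Var 0))
          (All (Iff (Rel SEnd (Var 0) (Var 1))
                    (Or (Rel SEnd (Var 0) (Const t)) (Eq (Var 0) (Var 1)))))) \<in> VW_star_Rel"
| ax6: "All (Ex (Rel (App d) (Var 1) (Var 0))) \<in> VW_star_Rel"
| ax7: "All (Ex (Rel (Prep d) (Var 1) (Var 0))) \<in> VW_star_Rel"
| ax8: "All (All (All (Imp (And (Rel (App d) (Var 2) (Var 1)) (Rel (App d) (Var 2) (Var 0)))
          (Eq (Var 1) (Var 0))))) \<in> VW_star_Rel"
| ax9: "All (All (All (Imp (And (Rel (Prep d) (Var 2) (Var 1)) (Rel (Prep d) (Var 2) (Var 0)))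
          (Eq (Var 1) (Var 0))))) \<in> VW_star_Rel"
| init_empty: "Rel SInit (Const []) (Const t) \<in> VW_star_Rel"
| init_of_empty: "All (Imp (Rel SInit (Var 0) (Const [])) (Eq (Var 0) (Const []))) \<in> VW_star_Rel"
| end_empty: "Rel SEnd (Const []) (Const t) \<in> VW_star_Rel"
| end_of_empty: "All (Imp (Rel SEnd (Var 0) (Const [])) (Eq (Var 0) (Const []))) \<in> VW_star_Rel"
| init_antisym: "All (All (Imp (And (Rel SInit (Var 1) (Var 0)) (Rel SInit (Var 0) (Var 1)))
          (Eq (Var 1) (Var 0)))) \<in> VW_star_Rel"

datatype vw0_sym = Init | End

abbreviation Strict :: "'r \<Rightarrow> 'c trm \<Rightarrow> 'c trm \<Rightarrow> ('c, 'r) fm" where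
  "Strict r x y \<equiv> And (Rel r x y) (Neg (Eq x y))"

inductive_set VW0 :: "(word, vw0_sym) fm set" where
  ax1: "s \<noteq> t \<Longrightarrow> Neg (Eq (Const s) (Const t)) \<in> VW0"
| ax2: "All (Iff (Rel Init (Var 0) (Const t))
          (Disj (map (\<lambda>s. Eq (Var 0) (Const s)) (prefixes t)))) \<in> VW0"
| ax3: "All (Iff (Rel End (Var 0) (Const t))
          (Disj (map (\<lambda>s. Eq (Var 0) (Const s)) (suffixes t)))) \<in> VW0"
| ax4: "All (Imp (All (Iff (Strict Init (Var 0) (Var 1)) (Strict Init (Var 0) (Const t))))
          (Conj (map (\<lambda>d. Imp (And (Rel End (Const [d]) (Var 0)) (Rel End (Const [d]) (Const t)))
                              (Eq (Var 0) (Const t))) [L1, L2]))) \<in> VW0"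
| ax5: "All (Imp (All (Iff (Strict End (Var 0) (Var 1)) (Strict End (Var 0) (Const t))))
          (Conj (map (\<lambda>d. Imp (And (Rel Init (Const [d]) (Var 0)) (Rel Init (Const [d]) (Const t)))
                              (Eq (Var 0) (Const t))) [L1, L2]))) \<in> VW0"
| ax10: "All (All (Imp (And (Rel Init (Var 1) (Var 0)) (Rel Init (Var 0) (Var 1)))
          (Eq (Var 1) (Var 0)))) \<in> VW0"

end

theory Submission
  imports Defs "HOL-Library.Countable"
begin

text \<open>
  A relation symbol for the graph of \<open>x \<mapsto> x\<^sup>\<frown>d\<close> is interpreted by saying that the proper initial
  segments of \<open>y\<close> are the initial segments of \<open>x\<close> and that \<open>d\<close> is an end segment of \<open>y\<close>. For
  standard \<open>x = t\<close> axiom (4) of \<open>VW0\<close> makes \<open>y = td\<close> the only solution; for those \<open>x\<close> that do not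
  have exactly one solution the interpretation takes the value \<open>x\<close> instead, which makes the relation
  a total function. Left extension is treated dually. Domain, identity and constants do not change.
  The provability claims are reduced to statements about models by the completeness theorem, proved
  by Henkin's method with the variables themselves as witnesses.
\<close>

section \<open>Substitution\<close>

lemma subst_trm_subst_trm:
  "subst_trm \<sigma> (subst_trm \<tau> t) = subst_trm (\<lambda>n. subst_trm \<sigma> (\<tau> n)) t"
  by (cases t) auto

lemma subst_subst: "subst \<sigma> (subst \<tau> p) = subst (\<lambda>n. subst_trm \<sigma> (\<tau> n)) p"
proof (induction p arbitrary: \<sigma> \<tau>)
  case (All p)
  have "(\<lambda>n. subst_trm (case_nat (Var 0) (\<lambda>n. lift_trm (\<sigma> n)))
          (case n of 0 \<Rightarrow> Var 0 | Suc n \<Rightarrow> lift_trm (\<tau> n)))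
      = case_nat (Var 0) (\<lambda>n. lift_trm (subst_trm \<sigma> (\<tau> n)))"
    by (auto simp: fun_eq_iff subst_trm_subst_trm split: nat.split)
  then show ?case
    by (simp add: All.IH)
qed (auto simp: subst_trm_subst_trm)

lemma trm_vars_below_mono: "trm_vars_below k t \<Longrightarrow> k \<le> m \<Longrightarrow> trm_vars_below m t"
  by (cases t) auto

lemma vars_below_mono: "vars_below k p \<Longrightarrow> k \<le> m \<Longrightarrow> vars_below m p"
  by (induction p arbitrary: k m) (auto intro: trm_vars_below_mono)

lemma ex_trm_vars_below: "\<exists>k. trm_vars_below k t"
  by (cases t) auto

lemma ex_vars_below: "\<exists>k. vars_below k p"
proof (induction p)
  case (Eq s t)
  obtain k m where "trm_vars_below k s" "trm_vars_below m t"
    using ex_trm_vars_below by meson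
  then have "vars_below (max k m) (Eq s t)"
    by (auto intro: trm_vars_below_mono)
  then show ?case ..
next
  case (Rel r s t)
  obtain k m where "trm_vars_below k s" "trm_vars_below m t"
    using ex_trm_vars_below by meson
  then have "vars_below (max k m) (Rel r s t)"
    by (auto intro: trm_vars_below_mono)
  then show ?case ..
next
  case (Imp p q)
  then obtain k m where "vars_below k p" "vars_below m q"
    by blast
  then have "vars_below (max k m) (Imp p q)"
    by (auto intro: vars_below_mono)
  then show ?case ..
next
  case (All p)
  then obtain k where "vars_below k p"
    by blast
  then have "vars_below k (All p)"
    by (auto intro: vars_below_mono)
  then show ?case ..
qed simp

lemma subst_trm_cong:
  "trm_vars_below k t \<Longrightarrow> (\<And>i. i < k \<Longrightarrow> \<sigma> i = \<tau> i) \<Longrightarrow> subst_trm \<sigma> t = subst_trm \<tau> t"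
  by (cases t) auto

text \<open>With \<open>k = 0\<close> all substitutions agree on a sentence; with a larger bound, a
  renaming may do anything to variables that do not occur.\<close>

lemma subst_cong:
  "vars_below k p \<Longrightarrow> (\<And>i. i < k \<Longrightarrow> \<sigma> i = \<tau> i) \<Longrightarrow> subst \<sigma> p = subst \<tau> p"
proof (induction p arbitrary: k \<sigma> \<tau>)
  case (All p)
  have "subst (case_nat (Var 0) (\<lambda>n. lift_trm (\<sigma> n))) p
      = subst (case_nat (Var 0) (\<lambda>n. lift_trm (\<tau> n))) p"
    using All.prems by (intro All.IH[of "Suc k"]) (auto split: nat.split)
  then show ?case
    by simp
next
  case (Imp p q)
  then show ?case
    using Imp.IH[of k \<sigma> \<tau>] by simp
qed (simp_all, (metis subst_trm_cong)+)

lemma subst_trm_Var: "subst_trm Var t = t"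
  by (cases t) auto

lemma subst_Var:
  fixes p :: "('c, 'r) fm"
  shows "subst Var p = p"
proof (induction p)
  case (All p)
  have "case_nat (Var 0) (\<lambda>n. Var (Suc n)) = (Var :: nat \<Rightarrow> 'c trm)"
    by (auto simp: fun_eq_iff split: nat.split)
  then show ?case
    by (simp add: All.IH)
qed (auto simp: subst_trm_Var)

lemma subst_trm_case_nat_lift: "subst_trm (case_nat t \<sigma>) (lift_trm s) = subst_trm \<sigma> s"
  by (cases s) auto

text \<open>The substitution carried under the binder fixes variable 0 and lifts the rest;
  instantiation then fills 0 and undoes the lift.\<close>

lemma inst_subst_up:
  "inst t (subst (case_nat (Var 0) (\<lambda>n. lift_trm (\<sigma> n))) p) = subst (case_nat t \<sigma>) p"
proof -
  have "(\<lambda>n. subst_trm (case_nat t Var) (case n of 0 \<Rightarrow> Var 0 | Suc n \<Rightarrow> lift_trm (\<sigma> n)))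
      = case_nat t \<sigma>"
    by (auto simp: fun_eq_iff subst_trm_case_nat_lift subst_trm_Var split: nat.split)
  then show ?thesis
    by (simp add: inst_def subst_subst)
qed

lemma subst_inst:
  "subst \<sigma> (inst t p) = inst (subst_trm \<sigma> t) (subst (case_nat (Var 0) (\<lambda>n. lift_trm (\<sigma> n))) p)"
proof -
  have "(\<lambda>n. subst_trm \<sigma> (case_nat t Var n)) = case_nat (subst_trm \<sigma> t) \<sigma>"
    by (auto simp: fun_eq_iff split: nat.split)
  then show ?thesis
    by (simp add: inst_subst_up) (simp add: inst_def subst_subst)
qed

section \<open>Provability\<close>

lemma weaken: "G \<turnstile> p \<Longrightarrow> G \<subseteq> H \<Longrightarrow> H \<turnstile> p"
proof (induction arbitrary: H rule: proves.induct)
  case (imp_intro p G q)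
  then show ?case
    by (meson insert_mono proves.imp_intro)
next
  case (classical p G)
  then show ?case
    by (meson insert_mono proves.classical)
next
  case (all_intro G p)
  then show ?case
    by (intro proves.all_intro all_intro.IH image_mono)
next
  case (eq_subst G s t p)
  then show ?case
    by (meson proves.eq_subst)
qed (auto intro: proves.intros)

text \<open>The case that matters is \<open>all_intro\<close>: the induction hypothesis is used at
  the substitution pushed under the binder, which keeps the eigenvariable 0 and maps lifted
  hypotheses to lifts of substituted ones.\<close>

lemma proves_subst: "G \<turnstile> p \<Longrightarrow> subst \<sigma> ` G \<turnstile> subst \<sigma> p"
proof (induction arbitrary: \<sigma> rule: proves.induct)
  case (imp_elim G p q)
  then show ?case
    by (metis subst.simps(4) proves.imp_elim)
next
  case (all_intro G p)
  have "subst (case_nat (Var 0) (\<lambda>n. lift_trm (\<sigma> n))) ` lift ` G = lift ` subst \<sigma> ` G"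
    by (simp add: image_image subst_subst)
  then show ?case
    using all_intro.IH by (metis proves.all_intro subst.simps(5))
next
  case (all_elim G p t)
  then show ?case
    by (simp add: subst_inst proves.all_elim)
next
  case (eq_subst G s t p)
  then show ?case
    unfolding subst_inst by (metis subst.simps(2) proves.eq_subst)
qed (auto intro: proves.intros)

text \<open>Serves to trace an inconsistency of the union of a chain back to a single
  member.\<close>

lemma proves_finite: "G \<turnstile> p \<Longrightarrow> \<exists>F\<subseteq>G. finite F \<and> F \<turnstile> p"
proof (induction rule: proves.induct)
  case (assm p G)
  then show ?case
    by (intro exI[of _ "{p}"]) (auto intro: proves.assm)
next
  case (imp_intro p G q)
  then obtain F where F: "F \<subseteq> insert p G" "finite F" "F \<turnstile> q"
    by blast
  then have "F - {p} \<turnstile> Imp p q"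
    by (intro proves.imp_intro weaken[OF F(3)]) blast
  then show ?case
    using F by (intro exI[of _ "F - {p}"]) auto
next
  case (imp_elim G p q)
  then obtain F E where "F \<subseteq> G" "finite F" "F \<turnstile> Imp p q" "E \<subseteq> G" "finite E" "E \<turnstile> p"
    by blast
  then show ?case
    by (intro exI[of _ "F \<union> E"]) (auto intro: proves.imp_elim weaken)
next
  case (classical p G)
  then obtain F where F: "F \<subseteq> insert (Neg p) G" "finite F" "F \<turnstile> Falsum"
    by blast
  have "F - {Neg p} \<turnstile> p"
    by (rule proves.classical[OF weaken[OF F(3)]]) blast
  then show ?case
    using F by (intro exI[of _ "F - {Neg p}"]) auto
next
  case (all_intro G p)
  then obtain F where "F \<subseteq> lift ` G" "finite F" "F \<turnstile> p"
    by blast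
  then show ?case
    by (metis finite_subset_image proves.all_intro)
next
  case (all_elim G p t)
  then show ?case
    by (meson proves.all_elim)
next
  case (eq_refl G t)
  then show ?case
    by (meson empty_subsetI finite.emptyI proves.eq_refl)
next
  case (eq_subst G s t p)
  then obtain F E where "F \<subseteq> G" "finite F" "F \<turnstile> Eq s t" "E \<subseteq> G" "finite E" "E \<turnstile> inst s p"
    by blast
  then show ?case
    by (intro exI[of _ "F \<union> E"]) (auto intro: proves.eq_subst weaken)
qed

text \<open>Generalization over a named variable \<open>k\<close> is reduced to the de Bruijn rule
  \<open>all_intro\<close>, whose eigenvariable is index 0, by a renaming.\<close>

lemma fresh_generalization:
  assumes "\<And>q. q \<in> G \<Longrightarrow> vars_below k q" and "vars_below (Suc k) p" and "G \<turnstile> inst (Var k) p"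
  shows "G \<turnstile> All p"
proof -
  \<comment> \<open>The fresh \<open>k\<close> becomes 0 and all other variables move up by one. So
    \<open>\<sigma>\<close> acts as \<open>lift\<close> on \<open>G\<close> and turns the instance
    back into \<open>p\<close>.\<close>
  define \<sigma> :: "nat \<Rightarrow> 'a trm" where "\<sigma> n = (if n = k then Var 0 else Var (Suc n))" for n
  have "subst \<sigma> q = lift q" if "q \<in> G" for q
    using assms(1)[OF that] by (rule subst_cong) (simp add: \<sigma>_def)
  then have G: "subst \<sigma> ` G = lift ` G"
    by (auto simp: image_iff)
  have "subst \<sigma> (inst (Var k) p) = subst (\<lambda>n. subst_trm \<sigma> (case_nat (Var k) Var n)) p"
    by (simp add: inst_def subst_subst)
  also have "\<dots> = subst Var p"
    using assms(2) by (rule subst_cong) (auto simp: \<sigma>_def split: nat.split)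
  finally have "lift ` G \<turnstile> p"
    using proves_subst[OF assms(3), of \<sigma>] by (simp add: G subst_Var)
  then show ?thesis
    by (rule proves.all_intro)
qed

section \<open>Completeness\<close>

instance trm :: (countable) countable
  by countable_datatype

instance fm :: (countable, countable) countable
  by countable_datatype

primrec eval_trm :: "('c \<Rightarrow> 'a) \<Rightarrow> (nat \<Rightarrow> 'a) \<Rightarrow> 'c trm \<Rightarrow> 'a" where
  "eval_trm C e (Var n) = e n"
| "eval_trm C e (Const c) = C c"

text \<open>The domain is a set rather than a type because the term model consists of equivalence
  classes. Constants and environments are tied to it only by separate assumptions such as
  \<open>range C \<subseteq> D\<close>.\<close>

primrec eval :: "'a set \<Rightarrow> ('c \<Rightarrow> 'a) \<Rightarrow> ('r \<Rightarrow> 'a \<Rightarrow> 'a \<Rightarrow> bool) \<Rightarrow> (nat \<Rightarrow> 'a)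
    \<Rightarrow> ('c, 'r) fm \<Rightarrow> bool" where
  "eval D C R e Falsum \<longleftrightarrow> False"
| "eval D C R e (Eq s t) \<longleftrightarrow> eval_trm C e s = eval_trm C e t"
| "eval D C R e (Rel r s t) \<longleftrightarrow> R r (eval_trm C e s) (eval_trm C e t)"
| "eval D C R e (Imp p q) \<longleftrightarrow> (eval D C R e p \<longrightarrow> eval D C R e q)"
| "eval D C R e (All p) \<longleftrightarrow> (\<forall>a\<in>D. eval D C R (case_nat a e) p)"

section \<open>Maximal consistent sets with witnesses\<close>

text \<open>The last clause is the witness property in universal form: a universal formula outside
  \<open>M\<close> has a counterexample among the terms.\<close>

definition henkin :: "('c, 'r) fm set \<Rightarrow> bool" where
  "henkin M \<longleftrightarrow> \<not> M \<turnstile> Falsum \<and> (\<forall>p. p \<in> M \<or> Neg p \<in> M) \<and>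
     (\<forall>p. All p \<in> M \<or> (\<exists>t. Neg (inst t p) \<in> M))"

text \<open>The common bound on free variables leaves a fresh variable at every stage, so no new
  constants have to be added.\<close>

definition extendable :: "('c, 'r) fm set \<Rightarrow> bool" where
  "extendable H \<longleftrightarrow> (\<exists>k. \<forall>q\<in>H. vars_below k q) \<and> \<not> H \<turnstile> Falsum"

definition decides :: "('c, 'r) fm set \<Rightarrow> ('c, 'r) fm \<Rightarrow> bool" where
  "decides H p \<longleftrightarrow>
     (p \<in> H \<or> Neg p \<in> H) \<and> (\<forall>r. p = All r \<longrightarrow> p \<in> H \<or> (\<exists>t. Neg (inst t r) \<in> H))"

text \<open>Add \<open>p\<close> if that is consistent and \<open>Neg p\<close> otherwise; in the
  latter case, if \<open>p\<close> is universal, also refute its instance at a fresh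
  variable.\<close>

lemma henkin_step:
  assumes "extendable H"
  shows "\<exists>H'. H \<subseteq> H' \<and> extendable H' \<and> decides H' p"
proof -
  have bounded: "\<exists>k. \<forall>q\<in>H. vars_below k q" and consistent: "\<not> H \<turnstile> Falsum"
    using assms unfolding extendable_def by blast+
  have bounded_insert: "\<exists>k. \<forall>q\<in>insert p G. vars_below k q"
    if "\<exists>k. \<forall>q\<in>G. vars_below k q" for p and G :: "('a, 'b) fm set"
  proof -
    from that obtain k where "\<forall>q\<in>G. vars_below k q"
      by blast
    moreover obtain m where "vars_below m p"
      using ex_vars_below by blast
    ultimately have "\<forall>q\<in>insert p G. vars_below (max k m) q"
      by (auto intro: vars_below_mono)
    then show ?thesis ..
  qed
  show ?thesis
  proof (cases "insert p H \<turnstile> Falsum")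
    case False
    then show ?thesis
      using bounded_insert[OF bounded, of p] by (intro exI[of _ "insert p H"]) (auto simp: extendable_def decides_def)
  next
    case True
    let ?H = "insert (Neg p) H"
    have neg: "\<not> ?H \<turnstile> Falsum"
      using True consistent proves.classical proves.imp_intro proves.imp_elim by metis
    show ?thesis
    proof (cases "\<exists>r. p = All r")
      case False
      then show ?thesis
        using neg bounded_insert[OF bounded, of "Neg p"] by (intro exI[of _ "?H"]) (auto simp: extendable_def decides_def)
    next
      case True
      then obtain r where r: "p = All r"
        by blast
      obtain k where k: "\<forall>q\<in>?H. vars_below k q"
        using bounded_insert[OF bounded] by blast
      let ?H' = "insert (Neg (inst (Var k) r)) ?H"
      \<comment> \<open>Otherwise \<open>?H\<close> would prove the instance at \<open>k\<close>; as
        \<open>k\<close> is fresh, generalization yields \<open>p\<close> itself, against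
        \<open>Neg p\<close>.\<close>
      have "\<not> ?H' \<turnstile> Falsum"
      proof
        assume "?H' \<turnstile> Falsum"
        then have "?H \<turnstile> inst (Var k) r"
          by (rule proves.classical)
        then have "?H \<turnstile> p"
          unfolding r using k by (intro fresh_generalization) (auto simp: r)
        then show False
          using neg by (meson insertI1 proves.assm proves.imp_elim)
      qed
      then show ?thesis
        using r bounded_insert[OF bounded_insert[OF bounded], of "Neg (inst (Var k) r)" "Neg p"]
        by (intro exI[of _ "?H'"]) (auto simp: extendable_def decides_def)
    qed
  qed
qed

lemma ex_henkin:
  fixes G :: "('c::countable, 'r::countable) fm set"
  assumes "extendable G"
  shows "\<exists>M. G \<subseteq> M \<and> henkin M"
proof -
  let ?P = "\<lambda>H :: ('c, 'r) fm set. G \<subseteq> H \<and> extendable H"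
  let ?Q = "\<lambda>n H H' :: ('c, 'r) fm set. H \<subseteq> H' \<and> decides H' (from_nat n)"
  \<comment> \<open>Stage \<open>n\<close> settles the formula with code \<open>n\<close>. Since
    every formula has a code, the union of the stages settles all of them.\<close>
  have "\<exists>H. \<forall>n. ?P (H n) \<and> ?Q n (H n) (H (Suc n))"
  proof (rule dependent_nat_choice)
    show "\<exists>H. ?P H"
      using assms by blast
  next
    fix H n
    assume "?P H"
    then show "\<exists>H'. ?P H' \<and> ?Q n H H'"
      using henkin_step[of H "from_nat n"] by (meson order_trans)
  qed
  then obtain H where H: "\<forall>n. ?P (H n) \<and> ?Q n (H n) (H (Suc n))" ..
  then have P: "?P (H n)" and Q: "?Q n (H n) (H (Suc n))" for n
    by simp_all
  have mono: "H m \<subseteq> H n" if "m \<le> n" for m n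
    using lift_Suc_mono_le[of H m n] Q that by blast
  have "\<not> \<Union> (range H) \<turnstile> Falsum"
  proof
    assume "\<Union> (range H) \<turnstile> Falsum"
    then obtain F where F: "F \<subseteq> \<Union> (range H)" "finite F" "F \<turnstile> Falsum"
      using proves_finite by blast
    \<comment> \<open>The stages form a chain, so finitely many formulas already lie in one of them,
      which is consistent.\<close>
    have "\<exists>n. F \<subseteq> H n"
      using F(2,1)
    proof (induction rule: finite_induct)
      case (insert q F)
      then obtain m n where "F \<subseteq> H m" "q \<in> H n"
        by blast
      then have "insert q F \<subseteq> H (max m n)"
        using mono[of m "max m n"] mono[of n "max m n"] by auto
      then show ?case ..
    qed simp
    then show False
      using F(3) P weaken unfolding extendable_def by blast
  qed
  moreover have "p \<in> \<Union> (range H) \<or> Neg p \<in> \<Union> (range H)" for p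
    using Q[of "to_nat p"] unfolding decides_def by auto
  moreover have "All p \<in> \<Union> (range H) \<or> (\<exists>t. Neg (inst t p) \<in> \<Union> (range H))" for p
    using Q[of "to_nat (All p)"] unfolding decides_def by auto
  ultimately have "henkin (\<Union> (range H))"
    unfolding henkin_def by blast
  then show ?thesis
    using P by blast
qed

section \<open>The term model of a Henkin set\<close>

context
  fixes M :: "('c, 'r) fm set"
  assumes henkin: "henkin M"
begin

lemma henkin_closed: "p \<in> M" if "M \<turnstile> p"
  using henkin that unfolding henkin_def by (meson proves.assm proves.imp_elim)

lemma henkin_Falsum: "Falsum \<notin> M"
  using henkin unfolding henkin_def by (meson proves.assm)

lemma henkin_Neg: "Neg p \<in> M \<longleftrightarrow> p \<notin> M"
  using henkin unfolding henkin_def by (meson proves.assm proves.imp_elim)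

lemma henkin_Imp: "Imp p q \<in> M \<longleftrightarrow> (p \<in> M \<longrightarrow> q \<in> M)"
proof
  assume "Imp p q \<in> M"
  then show "p \<in> M \<longrightarrow> q \<in> M"
    by (meson henkin_closed proves.assm proves.imp_elim)
next
  assume "p \<in> M \<longrightarrow> q \<in> M"
  then consider "Neg p \<in> M" | "q \<in> M"
    using henkin_Neg by blast
  then show "Imp p q \<in> M"
  proof cases
    case 1
    have "insert (Neg q) (insert p M) \<turnstile> Falsum"
      using 1 by (intro proves.imp_elim[of _ p Falsum] proves.assm) auto
    then show ?thesis
      by (rule henkin_closed[OF proves.imp_intro[OF proves.classical]])
  next
    case 2
    then show ?thesis
      by (intro henkin_closed proves.imp_intro proves.assm) auto
  qed
qed

lemma henkin_All: "All p \<in> M \<longleftrightarrow> (\<forall>t. inst t p \<in> M)"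
proof
  assume "All p \<in> M"
  then show "\<forall>t. inst t p \<in> M"
    by (meson henkin_closed proves.assm proves.all_elim)
next
  assume "\<forall>t. inst t p \<in> M"
  then show "All p \<in> M"
    using henkin henkin_Neg unfolding henkin_def by blast
qed

lemma henkin_Eq_refl: "Eq t t \<in> M"
  by (intro henkin_closed proves.eq_refl)

lemma henkin_Eq_subst: "Eq s t \<in> M \<Longrightarrow> inst s p \<in> M \<Longrightarrow> inst t p \<in> M"
  by (meson henkin_closed proves.assm proves.eq_subst)

text \<open>Leibniz's law for the property of being equal to \<open>s\<close>; lifting
  \<open>s\<close> keeps its variables apart from the instantiated one. Transitivity and congruence
  follow the same pattern.\<close>

lemma henkin_Eq_sym: "Eq s t \<in> M \<Longrightarrow> Eq t s \<in> M"
  using henkin_Eq_subst[of s t "Eq (Var 0) (lift_trm s)"] henkin_Eq_refl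
  by (simp add: inst_def subst_trm_case_nat_lift subst_trm_Var)

lemma henkin_Eq_trans: "Eq s t \<in> M \<Longrightarrow> Eq t u \<in> M \<Longrightarrow> Eq s u \<in> M"
  using henkin_Eq_subst[of t u "Eq (lift_trm s) (Var 0)"]
  by (simp add: inst_def subst_trm_case_nat_lift subst_trm_Var)

lemma henkin_Rel_cong:
  assumes "Eq s s' \<in> M" "Eq t t' \<in> M" "Rel r s t \<in> M"
  shows "Rel r s' t' \<in> M"
  using henkin_Eq_subst[OF assms(1), of "Rel r (Var 0) (lift_trm t)"]
    henkin_Eq_subst[OF assms(2), of "Rel r (lift_trm s') (Var 0)"] assms(3)
  by (simp add: inst_def subst_trm_case_nat_lift subst_trm_Var)

definition eq_class :: "'c trm \<Rightarrow> 'c trm set" where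
  "eq_class t = {u. Eq t u \<in> M}"

lemma eq_class_eq_iff: "eq_class s = eq_class t \<longleftrightarrow> Eq s t \<in> M"
  unfolding eq_class_def using henkin_Eq_refl henkin_Eq_sym henkin_Eq_trans by blast

text \<open>Representatives are quantified existentially; congruence makes their choice
  immaterial.\<close>

definition class_rel :: "'r \<Rightarrow> 'c trm set \<Rightarrow> 'c trm set \<Rightarrow> bool" where
  "class_rel r a b \<longleftrightarrow> (\<exists>s t. a = eq_class s \<and> b = eq_class t \<and> Rel r s t \<in> M)"

lemma class_rel_iff: "class_rel r (eq_class s) (eq_class t) \<longleftrightarrow> Rel r s t \<in> M"
  unfolding class_rel_def eq_class_eq_iff using henkin_Rel_cong henkin_Eq_refl henkin_Eq_sym by blast

lemma eval_trm_class:
  "eval_trm (\<lambda>c. eq_class (Const c)) (\<lambda>i. eq_class (\<sigma> i)) t = eq_class (subst_trm \<sigma> t)"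
  by (cases t) auto

text \<open>Stated for every \<open>\<sigma>\<close> so that the quantifier case goes through: each
  element of the domain is the class of a term \<open>t\<close>, and \<open>henkin_All\<close>
  ranges over exactly these terms.\<close>

lemma truth:
  "eval (range eq_class) (\<lambda>c. eq_class (Const c)) class_rel (\<lambda>i. eq_class (\<sigma> i)) p
    \<longleftrightarrow> subst \<sigma> p \<in> M"
proof (induction p arbitrary: \<sigma>)
  case (All p)
  have "case_nat (eq_class t) (\<lambda>i. eq_class (\<sigma> i)) = (\<lambda>i. eq_class (case_nat t \<sigma> i))" for t
    by (auto simp: fun_eq_iff split: nat.split)
  then show ?case
    by (simp add: All.IH henkin_All inst_subst_up)
qed (simp_all add: henkin_Falsum henkin_Imp eval_trm_class eq_class_eq_iff class_rel_iff)

end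

text \<open>Validity is assumed over the single carrier type of sets of terms, which suffices
  because the countermodel is a term model. Since \<open>G\<close> consists of sentences, any
  variable beyond those of \<open>p\<close> is fresh at the start.\<close>

theorem completeness:
  fixes G :: "('c::countable, 'r::countable) fm set"
  assumes sentences: "\<And>q. q \<in> G \<Longrightarrow> vars_below 0 q"
    and valid: "\<And>(D :: 'c trm set set) C R e. range C \<subseteq> D \<Longrightarrow> range e \<subseteq> D \<Longrightarrow>
      (\<And>q e. q \<in> G \<Longrightarrow> range e \<subseteq> D \<Longrightarrow> eval D C R e q) \<Longrightarrow> eval D C R e p"
  shows "G \<turnstile> p"
proof (rule ccontr)
  assume "\<not> G \<turnstile> p"
  then have consistent: "\<not> insert (Neg p) G \<turnstile> Falsum"
    using proves.classical by blast
  obtain k where "vars_below k (Neg p)"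
    using ex_vars_below by blast
  then have "\<forall>q\<in>insert (Neg p) G. vars_below k q"
    using sentences vars_below_mono by blast
  then have "extendable (insert (Neg p) G)"
    using consistent unfolding extendable_def by blast
  then obtain M where M: "insert (Neg p) G \<subseteq> M" "henkin M"
    using ex_henkin by blast
  note truth = truth[OF M(2)]
  let ?D = "range (eq_class M)" and ?C = "\<lambda>c. eq_class M (Const c)"
  have "eval ?D ?C (class_rel M) e q" if q: "q \<in> G" and e: "range e \<subseteq> ?D" for q e
  proof -
    \<comment> \<open>Choosing representatives presents the environment as a substitution, and a
      substitution does not change a sentence of \<open>G\<close>.\<close>
    from e have "\<forall>i. \<exists>t. e i = eq_class M t"
      by blast
    then obtain \<sigma> where "e = (\<lambda>i. eq_class M (\<sigma> i))"
      by metis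
    moreover have "subst \<sigma> q = subst Var q"
      using sentences[OF q] by (rule subst_cong) simp
    ultimately show ?thesis
      using q M(1) truth[of \<sigma> q] by (auto simp: subst_Var)
  qed
  \<comment> \<open>Under the environment sending each variable to its own class, truth is
    membership in \<open>M\<close>, yet \<open>Neg p\<close> belongs to \<open>M\<close>.\<close>
  then have "eval ?D ?C (class_rel M) (\<lambda>i. eq_class M (Var i)) p"
    by (intro valid) auto
  then show False
    using truth[of Var p] henkin_Neg[OF M(2), of p] M(1) by (auto simp: subst_Var)
qed

section \<open>The interpretation\<close>

lemma eval_And: "eval D C R e (And p q) \<longleftrightarrow> eval D C R e p \<and> eval D C R e q"
  by simp

lemma eval_Iff: "eval D C R e (Iff p q) \<longleftrightarrow> (eval D C R e p \<longleftrightarrow> eval D C R e q)"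
  by auto

lemma eval_Disj: "eval D C R e (Disj ps) \<longleftrightarrow> (\<exists>p\<in>set ps. eval D C R e p)"
  unfolding Disj_def by (induction ps) auto

lemma eval_Conj: "eval D C R e (Conj ps) \<longleftrightarrow> (\<forall>p\<in>set ps. eval D C R e p)"
  unfolding Conj_def by (induction ps) auto

lemma vars_below_Disj: "vars_below k (Disj ps) \<longleftrightarrow> (\<forall>p\<in>set ps. vars_below k p)"
  unfolding Disj_def by (induction ps) auto

lemma vars_below_Conj: "vars_below k (Conj ps) \<longleftrightarrow> (\<forall>p\<in>set ps. vars_below k p)"
  unfolding Conj_def by (induction ps) auto

lemma eval_trm_subst_trm: "eval_trm C e (subst_trm \<sigma> t) = eval_trm C (\<lambda>n. eval_trm C e (\<sigma> n)) t"
  by (cases t) auto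

lemma eval_subst:
  "eval D C R e (subst \<sigma> p) \<longleftrightarrow> eval D C R (\<lambda>n. eval_trm C e (\<sigma> n)) p"
proof (induction p arbitrary: e \<sigma>)
  case (All p)
  have "(\<lambda>n. eval_trm C (case_nat a e) (case n of 0 \<Rightarrow> Var 0 | Suc n \<Rightarrow> lift_trm (\<sigma> n)))
      = case_nat a (\<lambda>n. eval_trm C e (\<sigma> n))" for a
    by (auto simp: fun_eq_iff eval_trm_subst_trm split: nat.split)
  then show ?case
    by (simp add: All.IH)
qed (auto simp: eval_trm_subst_trm)

lemma eval_inst: "eval D C R e (inst t p) \<longleftrightarrow> eval D C R (case_nat (eval_trm C e t) e) p"
proof -
  have "(\<lambda>n. eval_trm C e (case_nat t Var n)) = case_nat (eval_trm C e t) e"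
    by (auto simp: fun_eq_iff split: nat.split)
  then show ?thesis
    by (simp add: inst_def eval_subst)
qed

section \<open>Formulas for extension by one letter, and the translation\<close>

text \<open>In the next three formulas variable 0 is the shorter word and variable 1 the longer one.\<close>

definition next_word :: "'r \<Rightarrow> 'r \<Rightarrow> 'c \<Rightarrow> ('c, 'r) fm" where
  "next_word r q d =
     And (All (Iff (Strict r (Var 0) (Var 2)) (Rel r (Var 0) (Var 1)))) (Rel q (Const d) (Var 1))"

definition unique_next :: "'r \<Rightarrow> 'r \<Rightarrow> 'c \<Rightarrow> ('c, 'r) fm" where
  "unique_next r q d =
     All (Iff (subst (case_nat (Var 1) (\<lambda>_. Var 0)) (next_word r q d)) (Eq (Var 0) (Var 2)))"

definition total_next :: "'r \<Rightarrow> 'r \<Rightarrow> 'c \<Rightarrow> ('c, 'r) fm" where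
  "total_next r q d =
     Or (unique_next r q d)
        (And (Neg (Ex (subst (case_nat (Var 1) (\<lambda>_. Var 0)) (unique_next r q d))))
             (Eq (Var 1) (Var 0)))"

definition vw_translation :: "(word, vw_star_sym, word, vw0_sym) translation" where
  "vw_translation =
     \<lparr>Dom = Neg Falsum, Cst = (\<lambda>s. Eq (Var 0) (Const s)),
      Rl = (\<lambda>r. case r of
          App d \<Rightarrow> total_next Init End [d]
        | Prep d \<Rightarrow> total_next End Init [d]
        | SInit \<Rightarrow> Rel Init (Var 0) (Var 1)
        | SEnd \<Rightarrow> Rel End (Var 0) (Var 1))\<rparr>"

lemma vars_below_total_next: "vars_below 2 (total_next r q d)"
  by (simp add: total_next_def unique_next_def next_word_def)

lemma wf_vw_translation: "wf_translation vw_translation"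
  unfolding wf_translation_def vw_translation_def
  by (auto simp: vars_below_total_next split: vw_star_sym.split)

lemma VW0_sentences: "p \<in> VW0 \<Longrightarrow> vars_below 0 p"
  by (induction rule: VW0.induct) (auto simp: vars_below_Disj vars_below_Conj)

section \<open>The defined relations in a model\<close>

text \<open>Semantic form of \<open>next_word\<close>: \<open>R\<close> is one segment relation,
  \<open>Q\<close> the opposite one, and \<open>a\<close> denotes the added letter.\<close>

definition next_rel where
  "next_rel D R Q a x y \<longleftrightarrow> (\<forall>z\<in>D. R z y \<and> z \<noteq> y \<longleftrightarrow> R z x) \<and> Q a y"

definition unique_next_rel where
  "unique_next_rel D R Q a x y \<longleftrightarrow> (\<forall>z\<in>D. next_rel D R Q a x z \<longleftrightarrow> z = y)"

definition total_next_rel where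
  "total_next_rel D R Q a x y \<longleftrightarrow>
     unique_next_rel D R Q a x y \<or> (\<nexists>z. z \<in> D \<and> unique_next_rel D R Q a x z) \<and> y = x"

lemma eval_next_word:
  "eval D C R e (next_word r q d) \<longleftrightarrow> next_rel D (R r) (R q) (C d) (e 0) (e 1)"
  by (auto simp: next_word_def next_rel_def numeral_2_eq_2)

lemma eval_unique_next:
  "eval D C R e (unique_next r q d) \<longleftrightarrow> unique_next_rel D (R r) (R q) (C d) (e 0) (e 1)"
  by (auto simp: unique_next_def unique_next_rel_def eval_subst eval_next_word numeral_2_eq_2)

lemma eval_total_next:
  "eval D C R e (total_next r q d) \<longleftrightarrow> total_next_rel D (R r) (R q) (C d) (e 0) (e 1)"
  by (auto simp: total_next_def total_next_rel_def eval_subst eval_unique_next)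

lemma total_next_rel_total:
  "x \<in> D \<Longrightarrow> \<exists>y\<in>D. total_next_rel D R Q a x y"
  unfolding total_next_rel_def by blast

text \<open>Each disjunct determines its value, and a unique solution in \<open>D\<close> excludes
  the default branch.\<close>

lemma total_next_rel_functional:
  "y \<in> D \<Longrightarrow> z \<in> D \<Longrightarrow> total_next_rel D R Q a x y \<Longrightarrow> total_next_rel D R Q a x z \<Longrightarrow> y = z"
  unfolding total_next_rel_def unique_next_rel_def by blast

text \<open>For standard \<open>x\<close>, where the default value \<open>x\<close> is never
  taken.\<close>

lemma total_next_rel_iff:
  assumes "u \<in> D" "y \<in> D" and "next_rel D R Q a x u"
    and "\<And>v. v \<in> D \<Longrightarrow> next_rel D R Q a x v \<Longrightarrow> v = u"
  shows "total_next_rel D R Q a x y \<longleftrightarrow> y = u"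
  using assms unfolding total_next_rel_def unique_next_rel_def by blast

section \<open>The structure for \<open>VW_star_Rel\<close> inside a model of
  \<open>VW0\<close>\<close>

definition vw_rel :: "'a set \<Rightarrow> (word \<Rightarrow> 'a) \<Rightarrow> (vw0_sym \<Rightarrow> 'a \<Rightarrow> 'a \<Rightarrow> bool)
    \<Rightarrow> vw_star_sym \<Rightarrow> 'a \<Rightarrow> 'a \<Rightarrow> bool" where
  "vw_rel D C R r = (case r of
       App d \<Rightarrow> total_next_rel D (R Init) (R End) (C [d])
     | Prep d \<Rightarrow> total_next_rel D (R End) (R Init) (C [d])
     | SInit \<Rightarrow> R Init
     | SEnd \<Rightarrow> R End)"

text \<open>A constant is eliminated by a quantifier over \<open>D\<close>, so its denotation must
  lie in \<open>D\<close>.\<close>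

lemma eval_with_value:
  assumes "range C \<subseteq> D"
  shows "eval D C R e (with_value vw_translation t p)
    \<longleftrightarrow> eval D C R (case_nat (eval_trm C e t) e) p"
  using assms by (cases t) (auto simp: eval_inst vw_translation_def)

lemma eval_Rl: "eval D C R e (Rl vw_translation r) \<longleftrightarrow> vw_rel D C R r (e 0) (e 1)"
  by (cases r) (auto simp: vw_translation_def vw_rel_def eval_total_next)

text \<open>\<open>Dom\<close> is always true, so relativizing the quantifiers changes nothing and
  only the relation symbols are reinterpreted.\<close>

lemma eval_translate:
  assumes "range C \<subseteq> D"
  shows "eval D C R e (translate vw_translation p) \<longleftrightarrow> eval D C (vw_rel D C R) e p"
proof (induction p arbitrary: e)
  case (All p)
  have "eval D C R e (Dom vw_translation)" for e
    by (simp add: vw_translation_def)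
  then show ?case
    by (simp add: All.IH)
qed (auto simp: eval_with_value[OF assms] eval_Rl eval_trm_subst_trm)

text \<open>Instances at standard words reduce to facts about words; totality and functionality hold
  at all elements by construction, and antisymmetry is inherited.\<close>

lemma vw_rel_models:
  assumes C: "range C \<subseteq> D" and e: "range e \<subseteq> D"
    and VW0: "\<And>q e. q \<in> VW0 \<Longrightarrow> range e \<subseteq> D \<Longrightarrow> eval D C R e q"
    and p: "p \<in> VW_star_Rel"
  shows "eval D C (vw_rel D C R) e p"
proof -
  note holds = VW0[OF _ e]
  have C_D: "C s \<in> D" for s
    using C by blast
  have inj: "C s = C t \<longleftrightarrow> s = t" for s t
    using holds[OF VW0.ax1, of s t] by auto
  have Init: "R Init x (C t) \<longleftrightarrow> (\<exists>s. prefix s t \<and> x = C s)" if "x \<in> D" for x t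
    using bspec[OF holds[OF VW0.ax2, of t, unfolded eval.simps(5)] that] by (auto simp: eval_Disj)
  have End: "R End x (C t) \<longleftrightarrow> (\<exists>s. suffix s t \<and> x = C s)" if "x \<in> D" for x t
    using bspec[OF holds[OF VW0.ax3, of t, unfolded eval.simps(5)] that] by (auto simp: eval_Disj)
  have letter: "d \<in> {L1, L2}" for d
    by (cases d) auto
  have Init_unique: "x = C t"
    if "x \<in> D" "\<forall>y\<in>D. R Init y x \<and> y \<noteq> x \<longleftrightarrow> R Init y (C t) \<and> y \<noteq> C t"
      "R End (C [d]) x" "R End (C [d]) (C t)" for x t d
    using bspec[OF holds[OF VW0.ax4, of t, unfolded eval.simps(5)] that(1)] that(2-4) letter[of d]
    by (auto simp: eval_Conj eval_And eval_Iff)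
  have End_unique: "x = C t"
    if "x \<in> D" "\<forall>y\<in>D. R End y x \<and> y \<noteq> x \<longleftrightarrow> R End y (C t) \<and> y \<noteq> C t"
      "R Init (C [d]) x" "R Init (C [d]) (C t)" for x t d
    using bspec[OF holds[OF VW0.ax5, of t, unfolded eval.simps(5)] that(1)] that(2-4) letter[of d]
    by (auto simp: eval_Conj eval_And eval_Iff)
  have antisym: "x = y" if "x \<in> D" "y \<in> D" "R Init x y" "R Init y x" for x y
    using holds[OF VW0.ax10] that by auto
  have strict_Init: "R Init z (C (t @ [d])) \<and> z \<noteq> C (t @ [d]) \<longleftrightarrow> R Init z (C t)"
    if "z \<in> D" for z t d
    using that by (auto simp: Init inj)
  have strict_End: "R End z (C (d # t)) \<and> z \<noteq> C (d # t) \<longleftrightarrow> R End z (C t)"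
    if "z \<in> D" for z t d
    \<comment> \<open>\<open>suffix_length_le\<close> rules out that \<open>d # t\<close> is an end
      segment of the shorter word \<open>t\<close>.\<close>
    using that by (auto simp: End inj suffix_Cons dest: suffix_length_le)
  have App: "vw_rel D C R (App d) (C t) y \<longleftrightarrow> y = C (t @ [d])" if "y \<in> D" for d t y
    unfolding vw_rel_def vw_star_sym.case
  proof (rule total_next_rel_iff[OF C_D that])
    have d: "R End (C [d]) (C (t @ [d]))"
      using C_D by (auto simp: End inj suffix_def)
    then show "next_rel D (R Init) (R End) (C [d]) (C t) (C (t @ [d]))"
      using strict_Init by (auto simp: next_rel_def)
    show "v = C (t @ [d])" if "v \<in> D" "next_rel D (R Init) (R End) (C [d]) (C t) v" for v
      \<comment> \<open>By \<open>strict_Init\<close>, \<open>v\<close> has the same proper initial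
        segments as the standard word; both end in \<open>d\<close>, so the uniqueness axiom
        identifies them.\<close>
      using that d strict_Init by (intro Init_unique[of v "t @ [d]" d]) (auto simp: next_rel_def)
  qed
  have Prep: "vw_rel D C R (Prep d) (C t) y \<longleftrightarrow> y = C (d # t)" if "y \<in> D" for d t y
    unfolding vw_rel_def vw_star_sym.case
  proof (rule total_next_rel_iff[OF C_D that])
    have d: "R Init (C [d]) (C (d # t))"
      using C_D by (auto simp: Init inj)
    then show "next_rel D (R End) (R Init) (C [d]) (C t) (C (d # t))"
      using strict_End by (auto simp: next_rel_def)
    show "v = C (d # t)" if "v \<in> D" "next_rel D (R End) (R Init) (C [d]) (C t) v" for v
      using that d strict_End by (intro End_unique[of v "d # t" d]) (auto simp: next_rel_def)
  qed
  have total: "\<exists>y\<in>D. vw_rel D C R (App d) x y" "\<exists>y\<in>D. vw_rel D C R (Prep d) x y"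
    if "x \<in> D" for d x
    using that by (simp_all add: vw_rel_def total_next_rel_total)
  have functional: "vw_rel D C R (App d) x y \<Longrightarrow> vw_rel D C R (App d) x z \<Longrightarrow> y = z"
    "vw_rel D C R (Prep d) x y \<Longrightarrow> vw_rel D C R (Prep d) x z \<Longrightarrow> y = z"
    if "y \<in> D" "z \<in> D" for d x y z
    using that by (auto simp: vw_rel_def dest: total_next_rel_functional)
  have SInit: "vw_rel D C R SInit = R Init" and SEnd: "vw_rel D C R SEnd = R End"
    by (simp_all add: vw_rel_def)
  show ?thesis
    using p
  proof cases
    case (ax4 d t)
    then show ?thesis
      \<comment> \<open>\<open>App\<close> forces the value to be the word \<open>t @ [d]\<close>,
        whose prefixes are those of \<open>t\<close> and itself.\<close>
      using C_D by (auto simp: App SInit Init inj)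
  next
    case (ax5 d t)
    then show ?thesis
      using C_D by (auto simp: Prep SEnd End inj suffix_Cons)
  next
    case (ax6 d)
    then show ?thesis
      using total by auto
  next
    case (ax7 d)
    then show ?thesis
      using total by auto
  next
    case (ax8 d)
    then show ?thesis
      using functional by (auto simp: numeral_2_eq_2)
  next
    case (ax9 d)
    then show ?thesis
      using functional by (auto simp: numeral_2_eq_2)
  next
    case init_antisym
    then show ?thesis
      using antisym by (auto simp: SInit)
  qed (use C_D in \<open>auto simp: App Prep SInit SEnd Init End inj\<close>)
qed

section \<open>Interpretability via completeness\<close>

instance letter :: countable
  by countable_datatype

instance vw0_sym :: countable
  by countable_datatype

theorem theorem7p5:
  shows "VW_star_Rel \<le>\<^sub>I VW0"
  unfolding interpretable_def
proof (intro exI[of _ vw_translation] conjI ballI allI)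
  show "wf_translation vw_translation"
    by (rule wf_vw_translation)
  show "VW0 \<turnstile> Ex (Dom vw_translation)"
  proof (rule completeness[OF VW0_sentences])
    fix D and C :: "word \<Rightarrow> word trm set" and R :: "vw0_sym \<Rightarrow> word trm set \<Rightarrow> word trm set \<Rightarrow> bool"
      and e :: "nat \<Rightarrow> word trm set"
    \<comment> \<open>The denotation of any constant shows that the domain is nonempty.\<close>
    assume "range C \<subseteq> D"
    then show "eval D C R e (Ex (Dom vw_translation))"
      by (auto simp: vw_translation_def)
  qed
  show "VW0 \<turnstile> Ex_unique (And (Dom vw_translation) (Cst vw_translation c))" for c
  proof (rule completeness[OF VW0_sentences])
    fix D and C :: "word \<Rightarrow> word trm set" and R :: "vw0_sym \<Rightarrow> word trm set \<Rightarrow> word trm set \<Rightarrow> bool"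
      and e :: "nat \<Rightarrow> word trm set"
    assume "range C \<subseteq> D"
    then show "eval D C R e (Ex_unique (And (Dom vw_translation) (Cst vw_translation c)))"
      by (auto simp: vw_translation_def Ex_unique_def)
  qed
  show "VW0 \<turnstile> translate vw_translation p" if "p \<in> VW_star_Rel" for p
    \<comment> \<open>In a model of \<open>VW0\<close>, a translated axiom says that the axiom holds
      in the structure given by \<open>vw_rel\<close>.\<close>
    using that by (intro completeness[OF VW0_sentences]) (simp_all add: eval_translate vw_rel_models)
qed

end
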